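(* Let $q$ be an odd prime power and let $\gamma\in\mathbb{F}_{q^2}$. The polynomial $f(x)=x+\gamma\,\mathrm{Tr}\left(x^{q+3}-x^{2q+2}\right)$ over $\mathbb{F}_{q^2}$ is a permutation polynomial if and only if $\gamma=0$.
   Context: $\mathrm{Tr}:\mathbb{F}_{q^2}\to\mathbb{F}_q$ is the trace map $\mathrm{Tr}(x)=x+x^q$. A polynomial $f$ over $\mathbb{F}_{q^2}$ is a permutation polynomial if the map $x\mapsto f(x)$ is a bijection of $\mathbb{F}_{q^2}$ onto itself. *)

theory Defs
  imports
    "HOL-Library.Cardinality"
    "HOL-Computational_Algebra.Polynomial"
    "HOL-Number_Theory.Prime_Powers"
begin

(* The relative trace of the quadratic extension with base field of order q. The type is
   left polymorphic so that it can be applied to a field element, where it is the trace map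
   from the field of order q^2 to the subfield of order q, and to a polynomial, where it is
   the same expression formed in the polynomial ring; the two agree under evaluation
   (lemma poly_Tr). *)
definition Tr :: "nat \<Rightarrow> 'a::comm_semiring_1 \<Rightarrow> 'a" where
  "Tr q x = x + x ^ q"

lemma poly_Tr: "poly (Tr q p) a = Tr q (poly p a)"
  by (simp add: Tr_def)

definition permutation_polynomial :: "'a::{field,finite} poly \<Rightarrow> bool" where
  "permutation_polynomial f \<longleftrightarrow> bij (poly f)"

end

theory Submission
  imports Defs
begin

text \<open>
  Write \<open>x = a + t \<delta>\<close> with \<open>a\<close>, \<open>t\<close> in the subfield \<open>K\<close> of order \<open>q\<close>, where \<open>\<delta>\<^sup>q = - \<delta>\<close> and
  \<open>d = \<delta>\<^sup>2\<close>. The trace in the theorem is \<open>x\<^bsup>q+1\<^esup> (x - x\<^sup>q)\<^sup>2 = 4 d t\<^sup>2 (a\<^sup>2 - d t\<^sup>2)\<close>. For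
  \<open>\<gamma> = u + v \<delta> \<noteq> 0\<close> two points of \<open>K \<times> K\<close> with the same image are written down explicitly. If
  \<open>u \<noteq> 0\<close>, they can be taken with equal values of \<open>t\<^sup>2\<close>, and the condition becomes linear. If
  \<open>u = 0\<close>, they can be taken with equal \<open>a\<close>; the condition is then a cubic surface, on which a
  representation of \<open>d\<close> as a sum of two squares in \<open>K\<close> yields a point.
\<close>

section \<open>Squares in a finite subfield of odd characteristic\<close>

locale finite_odd_subfield =
  fixes K :: "'a::field set"
  assumes finite: "finite K"
    and one_closed: "1 \<in> K"
    and add_closed: "\<And>x y. x \<in> K \<Longrightarrow> y \<in> K \<Longrightarrow> x + y \<in> K"
    and uminus_closed: "\<And>x. x \<in> K \<Longrightarrow> - x \<in> K"
    and mult_closed: "\<And>x y. x \<in> K \<Longrightarrow> y \<in> K \<Longrightarrow> x * y \<in> K"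
    and inverse_closed: "\<And>x. x \<in> K \<Longrightarrow> inverse x \<in> K"
    and two_neq_zero: "(2::'a) \<noteq> 0"
begin

lemma zero_closed: "0 \<in> K"
  using add_closed[OF one_closed uminus_closed[OF one_closed]] by simp

lemma diff_closed: "x \<in> K \<Longrightarrow> y \<in> K \<Longrightarrow> x - y \<in> K"
  using add_closed[OF _ uminus_closed, of x y] by simp

lemma divide_closed: "x \<in> K \<Longrightarrow> y \<in> K \<Longrightarrow> x / y \<in> K"
  by (simp add: divide_inverse mult_closed inverse_closed)

lemma power_closed: "x \<in> K \<Longrightarrow> x ^ n \<in> K"
  by (induction n) (simp_all add: one_closed mult_closed)

lemma numeral_closed: "numeral n \<in> K"
  by (induction n) (simp_all only: one_closed add_closed numeral.simps)

lemmas closed = zero_closed one_closed add_closed uminus_closed diff_closed mult_closed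
  inverse_closed divide_closed power_closed numeral_closed

lemma four_neq_zero: "(4::'a) \<noteq> 0"
proof -
  have "(4::'a) = 2 * 2" by simp
  then show ?thesis using two_neq_zero by (metis mult_eq_0_iff)
qed

text \<open>A square has at most the two roots r and -r, and 0 has only one, so K has at most 2 |S|
  - 1 elements, where S is the set of squares.\<close>

lemma card_less_squares: "card K < 2 * card ((\<lambda>x. x\<^sup>2) ` K)"
proof -
  define S where "S = (\<lambda>x. x\<^sup>2) ` K"
  define r where "r = inv_into K (\<lambda>x::'a. x\<^sup>2)"
  have r: "(r s)\<^sup>2 = s" if "s \<in> S" for s
    using f_inv_into_f[of s "\<lambda>x. x\<^sup>2" K] that by (simp add: S_def r_def)
  have S: "finite S" "0 \<in> S"
    using finite zero_closed by (force simp: S_def)+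
  have "K \<subseteq> r ` S \<union> (uminus \<circ> r) ` (S - {0})"
  proof
    fix x assume "x \<in> K"
    then have xS: "x\<^sup>2 \<in> S" by (simp add: S_def)
    have "r (x\<^sup>2) = x \<or> r (x\<^sup>2) = - x"
      using r[OF xS] by (simp add: power2_eq_iff)
    then consider "r (x\<^sup>2) = x" | "r (x\<^sup>2) = - x" "x \<noteq> 0"
      by (cases "x = 0") auto
    then show "x \<in> r ` S \<union> (uminus \<circ> r) ` (S - {0})"
    proof cases
      case 1
      then show ?thesis using xS by (metis UnI1 imageI)
    next
      case 2
      then have "x = (uminus \<circ> r) (x\<^sup>2)" "x\<^sup>2 \<in> S - {0}" using xS by auto
      then show ?thesis by blast
    qed
  qed
  then have "card K \<le> card (r ` S \<union> (uminus \<circ> r) ` (S - {0}))"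
    using S by (intro card_mono) auto
  also have "\<dots> \<le> card (r ` S) + card ((uminus \<circ> r) ` (S - {0}))"
    by (rule card_Un_le)
  also have "\<dots> \<le> card S + card (S - {0})"
    using S by (intro add_mono card_image_le) auto
  also have "\<dots> < 2 * card S"
    using S card_Diff1_less[of S 0] by simp
  finally show ?thesis by (simp add: S_def)
qed

text \<open>Both S and d - S fill more than half of K, so they meet.\<close>

lemma sum_of_two_squares:
  assumes "d \<in> K"
  obtains x y where "x \<in> K" "y \<in> K" "d = x\<^sup>2 + y\<^sup>2"
proof -
  define S where "S = (\<lambda>x. x\<^sup>2) ` K"
  have "S \<inter> (\<lambda>x. d - x) ` S \<noteq> {}"
  proof
    assume disj: "S \<inter> (\<lambda>x. d - x) ` S = {}"
    have "2 * card S = card S + card ((\<lambda>x. d - x) ` S)"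
      by (simp add: card_image inj_on_def)
    also have "\<dots> = card (S \<union> (\<lambda>x. d - x) ` S)"
      using disj finite by (intro card_Un_disjoint[symmetric]) (auto simp: S_def)
    also have "\<dots> \<le> card K"
      using assms finite by (intro card_mono) (auto simp: S_def intro!: closed)
    finally show False using card_less_squares by (simp add: S_def)
  qed
  then obtain x y where "x \<in> K" "y \<in> K" "x\<^sup>2 = d - y\<^sup>2" by (auto simp: S_def)
  then show thesis using that by (metis diff_add_cancel)
qed

section \<open>Explicit collisions in coordinates over the subfield\<close>

text \<open>
  The points with \<open>a\<close> fixed and \<open>t = (p \<plusminus> m) / 2\<close> collide iff \<open>p (e (m\<^sup>2 + p\<^sup>2) - a\<^sup>2) = w\<close>, where
  \<open>e = d / 2\<close> and \<open>w = 1 / (4 d v)\<close>. The conic at infinity contains \<open>(a, m, p) = (d, M, P)\<close>. On a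
  line \<open>l (d, M, P) + z (e M, d, 0)\<close> the cubic form reduces to \<open>l z\<^sup>2 e\<^sup>2 P\<^sup>3\<close>, since the two
  direction vectors are orthogonal for \<open>a\<^sup>2 - e m\<^sup>2\<close>.
\<close>
lemma collision_imaginary:
  assumes d: "d \<in> K" "d \<noteq> 0" and v: "v \<in> K" "v \<noteq> 0"
  obtains a t t' where "a \<in> K" "t \<in> K" "t' \<in> K" "t \<noteq> t'"
    "t + v * (4 * d * t\<^sup>2 * (a\<^sup>2 - d * t\<^sup>2)) = t' + v * (4 * d * t'\<^sup>2 * (a\<^sup>2 - d * t'\<^sup>2))"
proof -
  \<comment> \<open>If d = x^2 + y^2, then x + y and x - y have squares summing to 2 d. They do not
    both vanish, so one of them can serve as P.\<close>
  obtain M P where MP: "M \<in> K" "P \<in> K" "P \<noteq> 0" "M\<^sup>2 + P\<^sup>2 = 2 * d"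
  proof -
    obtain x y where xy: "x \<in> K" "y \<in> K" "d = x\<^sup>2 + y\<^sup>2"
      using sum_of_two_squares d by blast
    have "x + y \<noteq> 0 \<or> x - y \<noteq> 0"
    proof (rule ccontr)
      assume "\<not> ?thesis"
      then have "x + y = 0" "x = y" by auto
      then have "2 * y = 0" "x = y" by simp_all
      then show False using two_neq_zero d xy by simp
    qed
    moreover have "(x + y)\<^sup>2 + (x - y)\<^sup>2 = 2 * d" "(x - y)\<^sup>2 + (x + y)\<^sup>2 = 2 * d"
      by (simp_all add: xy(3) power2_eq_square algebra_simps)
    ultimately show thesis
      using that[of "x - y" "x + y"] that[of "x + y" "x - y"] xy closed by blast
  qed
  define e where "e = d / 2"
  define w where "w = 1 / (4 * d * v)"
  define l where "l = w / (e\<^sup>2 * P ^ 3)"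
  have de: "d = 2 * e" using two_neq_zero by (simp add: e_def)
  have e: "e \<in> K" "e \<noteq> 0"
    using d two_neq_zero by (auto simp: e_def intro!: closed)
  have w: "w \<in> K" "4 * d * v * w = 1"
    using d v four_neq_zero by (auto simp: w_def intro!: closed)
  have l: "l \<in> K" "l * (e\<^sup>2 * P ^ 3) = w"
    using e w MP by (auto simp: l_def intro!: closed)
  \<comment> \<open>The sign z is free because only z^2 enters the value of the cubic form. It is
    chosen to make m = t' - t nonzero.\<close>
  obtain z where z: "z = 1 \<or> z = - 1" "l * M + z * d \<noteq> 0"
  proof (rule ccontr)
    assume "\<not> thesis"
    then have "l * M + 1 * d = 0" "l * M + (- 1) * d = 0" using that by blast+
    moreover have "2 * d = (l * M + 1 * d) - (l * M + (- 1) * d)" unfolding mult_2 by simp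
    ultimately have "2 * d = 0" by simp
    then show False using d two_neq_zero by simp
  qed
  have zK: "z \<in> K" "z\<^sup>2 = 1" using z(1) closed by auto
  define a where "a = l * d + z * e * M"
  define m where "m = l * M + z * d"
  define p where "p = l * P"
  define t where "t = (p - m) / 2"
  define t' where "t' = (p + m) / 2"
  have p: "p = t' + t" and m: "m = t' - t"
    using two_neq_zero four_neq_zero by (simp_all add: t_def t'_def field_simps)
  have "m\<^sup>2 + p\<^sup>2 = l\<^sup>2 * (M\<^sup>2 + P\<^sup>2) + 2 * l * z * M * d + z\<^sup>2 * d\<^sup>2"
    by (simp add: m_def p_def power2_eq_square algebra_simps)
  also have "\<dots> = 4 * l\<^sup>2 * e + 4 * l * z * M * e + 4 * e\<^sup>2"
    unfolding MP(4) zK(2) by (simp add: de power2_eq_square algebra_simps)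
  finally have "e * (m\<^sup>2 + p\<^sup>2) = 4 * l\<^sup>2 * e\<^sup>2 + 4 * l * z * M * e\<^sup>2 + e\<^sup>2 * (4 * e)"
    by (simp add: power2_eq_square algebra_simps)
  \<comment> \<open>This splits off e^2 M^2, so that all terms of a^2 appear and only e^2 P^2
    survives the subtraction.\<close>
  also have "4 * e = M\<^sup>2 + P\<^sup>2"
    by (simp add: MP(4) de)
  finally have "e * (m\<^sup>2 + p\<^sup>2) =
      4 * l\<^sup>2 * e\<^sup>2 + 4 * l * z * M * e\<^sup>2 + z\<^sup>2 * e\<^sup>2 * M\<^sup>2 + e\<^sup>2 * P\<^sup>2"
    unfolding zK(2) by (simp add: algebra_simps)
  moreover have "a\<^sup>2 = 4 * l\<^sup>2 * e\<^sup>2 + 4 * l * z * M * e\<^sup>2 + z\<^sup>2 * e\<^sup>2 * M\<^sup>2"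
    by (simp add: a_def de power2_eq_square algebra_simps)
  ultimately have "e * (m\<^sup>2 + p\<^sup>2) - a\<^sup>2 = e\<^sup>2 * P\<^sup>2"
    by (simp only: add_diff_cancel_left')
  then have "4 * d * v * p * (e * (m\<^sup>2 + p\<^sup>2) - a\<^sup>2) = 4 * d * v * (l * (e\<^sup>2 * P ^ 3))"
    by (simp add: p_def power2_eq_square power3_eq_cube mult_ac)
  then have key: "4 * d * v * p * (e * (m\<^sup>2 + p\<^sup>2) - a\<^sup>2) = 1"
    using l(2) w(2) by simp
  show thesis
  proof (rule that[of a t t'])
    show "a \<in> K" "t \<in> K" "t' \<in> K"
      using zK l e d MP by (auto simp: a_def t_def t'_def p_def m_def intro!: closed)
    show "t \<noteq> t'" using z(2) m by (auto simp: m_def)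
    show "t + v * (4 * d * t\<^sup>2 * (a\<^sup>2 - d * t\<^sup>2)) = t' + v * (4 * d * t'\<^sup>2 * (a\<^sup>2 - d * t'\<^sup>2))"
    proof -
      have "v * (4 * d * t\<^sup>2 * (a\<^sup>2 - d * t\<^sup>2)) - v * (4 * d * t'\<^sup>2 * (a\<^sup>2 - d * t'\<^sup>2)) =
          m * (4 * d * v * p * (e * (m\<^sup>2 + p\<^sup>2) - a\<^sup>2))"
        by (simp add: p m de power2_eq_square algebra_simps)
      also have "\<dots> = t' - t" unfolding key by (simp add: m)
      finally show ?thesis by (simp add: algebra_simps)
    qed
  qed
qed

lemma collision:
  assumes d: "d \<in> K" "d \<noteq> 0" and uv: "u \<in> K" "v \<in> K" "u \<noteq> 0 \<or> v \<noteq> 0"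
  defines "g \<equiv> \<lambda>a t. 4 * d * t\<^sup>2 * (a\<^sup>2 - d * t\<^sup>2)"
  obtains a t a' t' where "a \<in> K" "t \<in> K" "a' \<in> K" "t' \<in> K" "(a, t) \<noteq> (a', t')"
    "a + u * g a t = a' + u * g a' t'" "t + v * g a t = t' + v * g a' t'"
proof (cases "u = 0")
  case True
  then show thesis
    using collision_imaginary[of d v] that d uv unfolding g_def by (metis mult_zero_left prod.inject)
next
  case False
  define b where "b = 1 / (4 * d * u)"
  have b: "b \<in> K" "4 * d * u * b = 1"
    using d uv False four_neq_zero by (auto simp: b_def intro!: closed)
  define h where "h = inverse (2::'a)"
  have h: "h \<in> K" "2 * h = 1" using two_neq_zero by (auto simp: h_def intro!: closed)
  show thesis
  proof (cases "v = 0")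
    case True
    \<comment> \<open>For t = t' = 1 the first coordinates agree iff a = a' or a + a' = -b. The
      normalization a - a' = 1 keeps the points distinct.\<close>
    define a where "a = h * (1 - b)"
    define a' where "a' = h * (- 1 - b)"
    have "a - a' = 2 * h" "a + a' = - (2 * h) * b"
      unfolding a_def a'_def mult_2 by (simp_all add: algebra_simps)
    then have a: "a - a' = 1" "a + a' = - b" using h(2) by simp_all
    show thesis
    proof (rule that[of a 1 a' 1])
      show "a \<in> K" "a' \<in> K" "1 \<in> K" "1 \<in> K"
        using b h by (auto simp: a_def a'_def intro!: closed)
      show "(a, 1) \<noteq> (a', 1)" using a(1) by auto
      have "(a + u * g a 1) - (a' + u * g a' 1) = (a - a') * (1 + 4 * d * u * (a + a'))"
        by (simp add: g_def power2_eq_square algebra_simps)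
      then show "a + u * g a 1 = a' + u * g a' 1" using a b(2) by simp
    qed (simp add: True)
  next
    case False
    \<comment> \<open>For t = -v and t' = v the second coordinates agree iff \<open>g\<close> drops
      by 2 between the points. The first coordinates then force a - a' = -2 u, and the drop itself
      forces a + a' = -c.\<close>
    define c where "c = b / v\<^sup>2"
    have c: "c \<in> K" "c * v\<^sup>2 = b" using b uv False by (auto simp: c_def intro!: closed)
    define a where "a = - u - h * c"
    define a' where "a' = u - h * c"
    have "a + a' = - (2 * h) * c" "a - a' = - 2 * u"
      unfolding a_def a'_def mult_2 by (simp_all add: algebra_simps)
    then have a: "a + a' = - c" "a - a' = - 2 * u" using h(2) by simp_all
    have "g a (- v) - g a' v = 4 * d * v\<^sup>2 * ((a + a') * (a - a'))"
      by (simp add: g_def power2_eq_square algebra_simps)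
    also have "\<dots> = 2 * (4 * d * u * (c * v\<^sup>2))" by (simp add: a)
    also have "\<dots> = 2" by (simp only: c(2) b(2) mult_1_right)
    finally have eq: "g a (- v) = g a' v + 2" by (simp add: algebra_simps)
    show thesis
    proof (rule that[of a "- v" a' v])
      show "a \<in> K" "a' \<in> K" "- v \<in> K" "v \<in> K"
        using b c h uv by (auto simp: a_def a'_def intro!: closed)
      have "2 * v \<noteq> 0" using False two_neq_zero by simp
      then have "- v \<noteq> v" unfolding mult_2 by (metis add.left_inverse)
      then show "(a, - v) \<noteq> (a', v)" by simp
      have "a + 2 * u = a'" by (simp add: a_def a'_def)
      then show "a + u * g a (- v) = a' + u * g a' v"
        unfolding eq by (simp add: algebra_simps)
      show "- v + v * g a (- v) = v + v * g a' v"
        unfolding eq by (simp add: algebra_simps)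
    qed
  qed
qed

end

section \<open>Finite field facts\<close>

text \<open>The library has this only for the type class \<open>finite_field\<close>, of which \<open>{field, finite}\<close> is
  not a subsort.\<close>
lemma power_CARD_eq_same:
  fixes x :: "'a::{field,finite}"
  shows "x ^ CARD('a) = x"
proof (cases "x = 0")
  case False
  have "(\<Prod>y\<in>UNIV - {0}. y) = (\<Prod>y\<in>UNIV - {0}. x * y)"
    by (rule prod.reindex_bij_witness[of _ "\<lambda>y. x * y" "\<lambda>y. y / x"]) (use False in auto)
  also have "\<dots> = x ^ (CARD('a) - 1) * (\<Prod>y\<in>UNIV - {0}. y)"
    by (simp add: prod.distrib)
  finally have "x ^ (CARD('a) - 1) = 1" by simp
  then have "x ^ Suc (CARD('a) - 1) = x" by (simp only: power_Suc mult_1_right)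
  also have "Suc (CARD('a) - 1) = CARD('a)"
    using zero_less_card_finite[where 'a = 'a] by linarith
  finally show ?thesis .
qed simp

text \<open>Translation by 1 permutes the ring, so it leaves the sum of all elements
  unchanged.\<close>

lemma of_nat_CARD_eq_0: "of_nat CARD('a) = (0::'a::{comm_ring_1,finite})"
proof -
  have "(\<Sum>x\<in>UNIV. x) = (\<Sum>x\<in>UNIV. x + (1::'a))"
    by (rule sum.reindex_bij_witness[of _ "\<lambda>x. x + 1" "\<lambda>x. x - 1"]) auto
  then show ?thesis by (simp add: sum.distrib)
qed

section \<open>Passage to coordinates and conclusion\<close>

theorem theorem3p8:
  fixes q :: nat and \<gamma> :: "'a::{field,finite}"
  assumes "primepow q" and "odd q"
    and "CARD('a) = q ^ 2"
  shows "permutation_polynomial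
           (monom 1 1 + smult \<gamma> (Tr q (monom 1 (q + 3) - monom 1 (2 * q + 2))))
         \<longleftrightarrow> \<gamma> = 0"
proof
  let ?f = "monom 1 1 + smult \<gamma> (Tr q (monom 1 (q + 3) - monom 1 (2 * q + 2)))"
  \<comment> \<open>Identifying q as a power of the characteristic makes the map sending x to x^q
    additive.\<close>
  have "prime CHAR('a)"
    by (intro prime_CHAR_semidom finite_imp_CHAR_pos) simp
  moreover obtain p n where pn: "prime p" "q = p ^ n" "n > 0"
    using assms(1) by (auto simp: primepow_def)
  moreover have "CHAR('a) dvd p ^ (n * 2)"
    using of_nat_CARD_eq_0[where ?'a = 'a] assms(3) pn(2)
    by (simp only: of_nat_eq_0_iff_char_dvd power_mult)
  ultimately have "CHAR('a) = p"
    by (metis prime_dvd_power primes_dvd_imp_eq)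
  then have char: "prime CHAR('a)" "q = CHAR('a) ^ n" "CHAR('a) dvd q"
    using pn by simp_all
  have frob_add: "(x + y) ^ q = x ^ q + y ^ q" for x y :: 'a
    using freshmans_dream' char by blast
  have frob_minus: "(- x) ^ q = - (x ^ q)" for x :: 'a
    using assms(2) by simp
  have frob_diff: "(x - y) ^ q = x ^ q - y ^ q" for x y :: 'a
    using frob_add[of x "- y"] by (simp add: frob_minus)
  have frob_frob: "(x ^ q) ^ q = x" for x :: 'a
    using power_CARD_eq_same[of x] by (simp add: assms(3) power2_eq_square power_mult)
  have two: "(2::'a) \<noteq> 0"
  proof
    assume "(2::'a) = 0"
    then have "of_nat 2 = (0::'a)" by simp
    then have "CHAR('a) dvd 2" by (simp only: of_nat_eq_0_iff_char_dvd)
    then have "CHAR('a) = 2" using char(1) by (simp add: primes_dvd_imp_eq)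
    then show False using char(3) assms(2) by simp
  qed
  define K where "K = {x::'a. x ^ q = x}"
  have q: "q > 1" using assms(1) by (simp add: primepow_gt_Suc_0)
  have two_K: "(2::'a) ^ q = 2"
    using frob_add[of 1 1] by simp
  interpret finite_odd_subfield K
    using two q by unfold_locales
      (simp_all add: K_def frob_add power_mult_distrib power_inverse frob_minus)

  \<comment> \<open>Otherwise X^q - X would have q^2 roots.\<close>
  have "\<exists>x::'a. x ^ q \<noteq> x"
  proof (rule ccontr)
    assume no: "\<not> (\<exists>x::'a. x ^ q \<noteq> x)"
    define r :: "'a poly" where "r = monom 1 q - monom 1 1"
    have "coeff r q = 1" using q by (simp add: r_def)
    then have "r \<noteq> 0" by auto
    then have "card {x. poly r x = 0} \<le> degree r" by (rule card_poly_roots_bound)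
    also have "{x. poly r x = 0} = UNIV"
      using no by (simp add: r_def poly_monom)
    also have "degree r \<le> q"
      using q unfolding r_def by (intro degree_diff_le order.trans[OF degree_monom_le]) auto
    finally have "q * q \<le> q * 1" by (simp add: assms(3) power2_eq_square)
    then show False using q by simp
  qed
  then obtain y :: 'a where y: "y ^ q \<noteq> y" by blast
  define \<delta> where "\<delta> = y - y ^ q"
  have \<delta>: "\<delta> \<noteq> 0" "\<delta> ^ q = - \<delta>"
    using y by (simp_all add: \<delta>_def frob_diff frob_frob)
  define d where "d = \<delta>\<^sup>2"
  have "(\<delta>\<^sup>2) ^ q = (\<delta> ^ q)\<^sup>2" by (simp add: mult.commute flip: power_mult)
  then have d: "d \<in> K" "d \<noteq> 0" using \<delta> by (simp_all add: d_def K_def)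
  \<comment> \<open>Half the sum and half the difference of \<open>\<gamma>\<close> and its
    conjugate isolate its coordinates in the basis 1, \<open>\<delta>\<close>. In \<open>v\<close>,
    numerator and denominator both change sign under conjugation.\<close>
  define u where "u = (\<gamma> + \<gamma> ^ q) / 2"
  define v where "v = (\<gamma> - \<gamma> ^ q) / (2 * \<delta>)"
  have uv: "u \<in> K" "v \<in> K"
    using \<delta>(2) by (simp_all add: K_def u_def v_def power_divide power_mult_distrib two_K
        frob_add frob_diff frob_frob add.commute minus_divide_left)
  have \<gamma>: "\<gamma> = u + v * \<delta>"
    using \<delta>(1) two four_neq_zero by (simp add: u_def v_def field_simps)

  have Tr_eq: "Tr q (x ^ (q + 3) - x ^ (2 * q + 2)) = x * x ^ q * (x - x ^ q)\<^sup>2" for x :: 'a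
  proof -
    define X where "X = x ^ q"
    have "X ^ q = x" by (simp add: X_def frob_frob)
    moreover have "x ^ (q + 3) - x ^ (2 * q + 2) = X * x ^ 3 - X\<^sup>2 * x\<^sup>2"
      by (simp add: X_def power_add mult.commute[of 2 q] power_mult power2_eq_square)
    moreover have "(x ^ k) ^ q = X ^ k" "(X ^ k) ^ q = (X ^ q) ^ k" for k
      by (simp_all add: X_def mult_ac flip: power_mult)
    ultimately have "Tr q (x ^ (q + 3) - x ^ (2 * q + 2)) =
        (X * x ^ 3 - X\<^sup>2 * x\<^sup>2) + (x * X ^ 3 - x\<^sup>2 * X\<^sup>2)"
      by (simp add: Tr_def frob_diff power_mult_distrib)
    then show ?thesis
      by (simp add: X_def[symmetric] power2_eq_square power3_eq_cube algebra_simps)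
  qed
  define g where "g = (\<lambda>a t. 4 * d * t\<^sup>2 * (a\<^sup>2 - d * t\<^sup>2))"
  have poly_f: "poly ?f (a + t * \<delta>) = (a + u * g a t) + (t + v * g a t) * \<delta>"
    if "a \<in> K" "t \<in> K" for a t
  proof -
    have "(a + t * \<delta>) ^ q = a - t * \<delta>"
      using that \<delta>(2) by (simp add: K_def frob_add power_mult_distrib)
    moreover have "poly ?f x = x + \<gamma> * (x * x ^ q * (x - x ^ q)\<^sup>2)" for x
      unfolding Tr_eq[symmetric] by (simp add: poly_Tr poly_monom)
    ultimately have "poly ?f (a + t * \<delta>) =
        a + t * \<delta> + \<gamma> * ((a + t * \<delta>) * (a - t * \<delta>) * (a + t * \<delta> - (a - t * \<delta>))\<^sup>2)"
      by (simp only:)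
    then show ?thesis
      by (simp add: \<gamma> g_def d_def power2_eq_square algebra_simps)
  qed
  have indep: "a = a' \<and> t = t'"
    if "a + t * \<delta> = a' + t' * \<delta>" "a \<in> K" "t \<in> K" "a' \<in> K" "t' \<in> K" for a t a' t'
  proof -
    \<comment> \<open>Adding the conjugate equation eliminates \<open>\<delta>\<close>.\<close>
    have "(a + t * \<delta>) ^ q = (a' + t' * \<delta>) ^ q" using that(1) by simp
    then have "a - t * \<delta> = a' - t' * \<delta>"
      using that(2-) \<delta>(2) by (simp add: K_def frob_add power_mult_distrib)
    then have "(a + t * \<delta>) + (a - t * \<delta>) = (a' + t' * \<delta>) + (a' - t' * \<delta>)"
      using that(1) by (simp only:)
    then have "2 * a = 2 * a'" unfolding mult_2 by simp
    then show ?thesis using that(1) \<delta>(1) two by simp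
  qed
  show "\<gamma> = 0" if perm: "permutation_polynomial ?f"
  proof (rule ccontr)
    assume "\<gamma> \<noteq> 0"
    then have "u \<noteq> 0 \<or> v \<noteq> 0" using \<gamma> by auto
    then obtain a t a' t' where at: "a \<in> K" "t \<in> K" "a' \<in> K" "t' \<in> K" "(a, t) \<noteq> (a', t')"
        "a + u * g a t = a' + u * g a' t'" "t + v * g a t = t' + v * g a' t'"
      using collision[OF d uv] unfolding g_def by metis
    then have "poly ?f (a + t * \<delta>) = poly ?f (a' + t' * \<delta>)"
      by (simp only: poly_f)
    moreover have "inj (poly ?f)"
      using perm by (simp add: permutation_polynomial_def bij_is_inj)
    ultimately have "a + t * \<delta> = a' + t' * \<delta>" by (simp only: inj_eq)
    then show False using indep at by blast
  qed
next
  assume "\<gamma> = 0"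
  moreover have "poly (monom 1 1) = (id :: 'a \<Rightarrow> 'a)"
    by (auto simp: poly_monom)
  ultimately show "permutation_polynomial
      (monom 1 1 + smult \<gamma> (Tr q (monom 1 (q + 3) - monom 1 (2 * q + 2))))"
    by (simp add: permutation_polynomial_def)
qed

end
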